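(* Let $G_1=(V_1,E_1,\sigma_1,\mu_1)$ and $G_2=(V_2,E_2,\sigma_2,\mu_2)$ be balanced signed graphs (each equipped with a marking function). Then the corona product $G_1\circ G_2$ is unbalanced if and only if $G_2$ contains an edge of one of the following types: (i) a positive edge joining two oppositely marked nodes; (ii) a negative edge joining two positively marked nodes; (iii) a negative edge joining two negatively marked nodes.
   Context: A signed graph is $G=(V,E,\sigma,\mu)$ where $(V,E)$ is a simple graph, $\sigma:E\to\{+,-\}$ is the signature (edge signs), and $\mu:V\to\{+,-\}$ is a marking function determined by $\sigma$; the paper considers two markings: the canonical marking $\mu(v)=\prod_{e\ni v}\sigma(e)$ (product of the signs of the edges incident to $v$), and the plurality marking $\mu(v)=+$ if $d^+(v)\ge d^-(v)$ and $\mu(v)=-$ otherwise, where $d^\pm(v)$ is the number of positive/negative edges at $v$. A signed graph is balanced if every cycle contains an even number of negative edges (equivalently, per the paper's convention, all its cycles are balanced); otherwise unbalanced. Corona product: if $G_1$ has $n$ nodes $u_1,\dots,u_n$, then $G_1\circ G_2$ is obtained by taking one copy of $G_1$ and $n$ copies of $G_2$ (with their edge signs) and joining $u_i$ to every node of the $i$-th copy of $G_2$, the new edge between $u_i$ and the copy of $v\in V_2$ receiving the sign $\mu_1(u_i)\mu_2(v)$ (with $+\cdot+=-\cdot-=+$, $+\cdot-=-$). *)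

theory Defs
  imports Main
begin

datatype sign = Pos | Neg

instantiation sign :: comm_monoid_mult
begin

definition one_sign :: sign where
  "1 = Pos"

definition times_sign :: "sign \<Rightarrow> sign \<Rightarrow> sign" where
  "s * t = (if s = t then Pos else Neg)"

instance
proof
  fix a b c :: sign
  show "a * b * c = a * (b * c)"
    by (cases a; cases b; cases c) (simp_all add: times_sign_def)
  show "a * b = b * a"
    by (simp add: times_sign_def)
  show "1 * a = a"
    by (cases a) (simp_all add: times_sign_def one_sign_def)
qed

end

text \<open>
  An edge is the two-element set of its endpoints; \<open>esign\<close> is relevant only on \<open>edges\<close> and
  \<open>mark\<close> only on \<open>verts\<close>. The marking sits in a record extension because balance does not
  depend on it.
\<close>

record 'a sgraph =
  verts :: "'a set"
  edges :: "'a set set"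
  esign :: "'a set \<Rightarrow> sign"

record 'a marked_sgraph = "'a sgraph" +
  mark :: "'a \<Rightarrow> sign"

definition simple_graph :: "('a, 'm) sgraph_scheme \<Rightarrow> bool" where
  "simple_graph G \<longleftrightarrow> finite (verts G) \<and> verts G \<noteq> {} \<and>
     (\<forall>e\<in>edges G. \<exists>u\<in>verts G. \<exists>v\<in>verts G. u \<noteq> v \<and> e = {u, v})"

definition canonical_marking :: "('a, 'm) sgraph_scheme \<Rightarrow> 'a \<Rightarrow> sign" where
  "canonical_marking G v = (\<Prod>e\<in>{e\<in>edges G. v \<in> e}. esign G e)"

definition signed_degree :: "('a, 'm) sgraph_scheme \<Rightarrow> sign \<Rightarrow> 'a \<Rightarrow> nat" where
  "signed_degree G s v = card {e\<in>edges G. v \<in> e \<and> esign G e = s}"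

definition plurality_marking :: "('a, 'm) sgraph_scheme \<Rightarrow> 'a \<Rightarrow> sign" where
  "plurality_marking G v = (if signed_degree G Pos v \<ge> signed_degree G Neg v then Pos else Neg)"

definition signed_graph :: "'a marked_sgraph \<Rightarrow> bool" where
  "signed_graph G \<longleftrightarrow> simple_graph G \<and>
     ((\<forall>v\<in>verts G. mark G v = canonical_marking G v) \<or>
      (\<forall>v\<in>verts G. mark G v = plurality_marking G v))"

text \<open>
  A cycle is given by the list of its vertices, without repeating the first one at the end.
\<close>

definition cycle_edges :: "'a list \<Rightarrow> 'a set set" where
  "cycle_edges xs = (\<lambda>i. {xs ! i, xs ! (Suc i mod length xs)}) ` {..<length xs}"

definition is_cycle :: "('a, 'm) sgraph_scheme \<Rightarrow> 'a list \<Rightarrow> bool" where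
  "is_cycle G xs \<longleftrightarrow> length xs \<ge> 3 \<and> distinct xs \<and> set xs \<subseteq> verts G \<and> cycle_edges xs \<subseteq> edges G"

definition balanced :: "('a, 'm) sgraph_scheme \<Rightarrow> bool" where
  "balanced G \<longleftrightarrow> (\<forall>xs. is_cycle G xs \<longrightarrow> even (card {e\<in>cycle_edges xs. esign G e = Neg}))"

text \<open>
  In the corona product \<open>Inl u\<close> is the vertex \<open>u\<close> of the copy of \<open>G1\<close>, and \<open>Inr (u, v)\<close> is the
  vertex \<open>v\<close> in the copy of \<open>G2\<close> attached to \<open>u\<close>. The signs of the three kinds of edges are
  spelled out in the lemmas \<open>corona_sign_base\<close>, \<open>corona_sign_copy\<close> and \<open>corona_sign_join\<close>.
\<close>

definition corona_sign ::
  "'a marked_sgraph \<Rightarrow> 'b marked_sgraph \<Rightarrow> ('a + 'a \<times> 'b) set \<Rightarrow> sign" where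
  "corona_sign G1 G2 e =
     (if e \<subseteq> range Inl then esign G1 {u. Inl u \<in> e}
      else if e \<subseteq> range Inr then esign G2 {v. \<exists>u. Inr (u, v) \<in> e}
      else mark G1 (THE u. Inl u \<in> e) * mark G2 (THE v. \<exists>u. Inr (u, v) \<in> e))"

definition corona ::
  "'a marked_sgraph \<Rightarrow> 'b marked_sgraph \<Rightarrow> ('a + 'a \<times> 'b) sgraph" where
  "corona G1 G2 =
     \<lparr>verts = Inl ` verts G1 \<union> Inr ` (verts G1 \<times> verts G2),
      edges = {{Inl u, Inl v} |u v. {u, v} \<in> edges G1}
        \<union> {{Inr (u, v), Inr (u, w)} |u v w. u \<in> verts G1 \<and> {v, w} \<in> edges G2}
        \<union> {{Inl u, Inr (u, v)} |u v. u \<in> verts G1 \<and> v \<in> verts G2},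
      esign = corona_sign G1 G2\<rparr>"

lemma corona_sign_base: "esign (corona G1 G2) {Inl u, Inl v} = esign G1 {u, v}"
proof -
  have "{x. Inl x \<in> {Inl u, Inl v :: 'a + 'a \<times> 'b}} = {u, v}"
    by auto
  then show ?thesis
    by (simp add: corona_def corona_sign_def)
qed

lemma corona_sign_copy: "esign (corona G1 G2) {Inr (u, v), Inr (u, w)} = esign G2 {v, w}"
proof -
  have "{y. \<exists>x. Inr (x, y) \<in> {Inr (u, v), Inr (u, w) :: 'a + 'a \<times> 'b}} = {v, w}"
    by auto
  moreover have "Inr (u, v) \<notin> range (Inl :: 'a \<Rightarrow> 'a + 'a \<times> 'b)"
    by auto
  ultimately show ?thesis
    by (simp add: corona_def corona_sign_def)
qed

lemma corona_sign_join: "esign (corona G1 G2) {Inl u, Inr (u, v)} = mark G1 u * mark G2 v"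
proof -
  have "Inr (u, v) \<notin> range (Inl :: 'a \<Rightarrow> 'a + 'a \<times> 'b)"
    and "Inl u \<notin> range (Inr :: 'a \<times> 'b \<Rightarrow> 'a + 'a \<times> 'b)"
    by auto
  then show ?thesis
    by (simp add: corona_def corona_sign_def)
qed

lemma simple_graph_corona:
  assumes "simple_graph G1" and "simple_graph G2"
  shows "simple_graph (corona G1 G2)"
proof -
  have 1: "u \<in> verts G1 \<and> v \<in> verts G1 \<and> u \<noteq> v" if "{u, v} \<in> edges G1" for u v
    using assms(1) that by (force simp: simple_graph_def doubleton_eq_iff)
  have 2: "u \<in> verts G2 \<and> v \<in> verts G2 \<and> u \<noteq> v" if "{u, v} \<in> edges G2" for u v
    using assms(2) that by (force simp: simple_graph_def doubleton_eq_iff)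
  have "\<exists>x\<in>verts (corona G1 G2). \<exists>y\<in>verts (corona G1 G2). x \<noteq> y \<and> e = {x, y}"
    if "e \<in> edges (corona G1 G2)" for e
    using that
  proof (simp add: corona_def, elim disjE exE conjE)
    fix u v assume "e = {Inl u, Inl v}" "{u, v} \<in> edges G1"
    with 1[of u v] show "\<exists>x\<in>Inl ` verts G1 \<union> Inr ` (verts G1 \<times> verts G2).
      \<exists>y\<in>Inl ` verts G1 \<union> Inr ` (verts G1 \<times> verts G2). x \<noteq> y \<and> e = {x, y}"
      by (intro bexI[of _ "Inl u"] bexI[of _ "Inl v"]) auto
  next
    fix u v w assume "e = {Inr (u, v), Inr (u, w)}" "u \<in> verts G1" "{v, w} \<in> edges G2"
    with 2[of v w] show "\<exists>x\<in>Inl ` verts G1 \<union> Inr ` (verts G1 \<times> verts G2).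
      \<exists>y\<in>Inl ` verts G1 \<union> Inr ` (verts G1 \<times> verts G2). x \<noteq> y \<and> e = {x, y}"
      by (intro bexI[of _ "Inr (u, v)"] bexI[of _ "Inr (u, w)"]) auto
  next
    fix u v assume "e = {Inl u, Inr (u, v)}" "u \<in> verts G1" "v \<in> verts G2"
    then show "\<exists>x\<in>Inl ` verts G1 \<union> Inr ` (verts G1 \<times> verts G2).
      \<exists>y\<in>Inl ` verts G1 \<union> Inr ` (verts G1 \<times> verts G2). x \<noteq> y \<and> e = {x, y}"
      by (intro bexI[of _ "Inl u"] bexI[of _ "Inr (u, v)"]) auto
  qed
  moreover have "finite (verts (corona G1 G2))" "verts (corona G1 G2) \<noteq> {}"
    using assms by (auto simp: corona_def simple_graph_def)
  ultimately show ?thesis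
    by (simp add: simple_graph_def)
qed

end

theory Submission
  imports Defs
begin

text \<open>
  Each of the three edge types says that \<open>\<sigma>(vw) \<noteq> \<mu>(v) \<mu>(w)\<close>. Such an edge closes a negative
  triangle with the vertex of \<open>G1\<close> its copy is attached to. Conversely, the vertex \<open>u\<close> of \<open>G1\<close> is
  the only way out of its copy of \<open>G2\<close>, so a cycle of the corona is either a cycle of \<open>G1\<close> or
  stays within a single copy together with \<open>u\<close>. If no bad edge exists, all edge signs in the latter
  part are products of the marks of the endpoints, so the sign of a cycle there is a square.
\<close>

section \<open>Products of signs\<close>

lemma sign_square [simp]: "s * s = (1 :: sign)"
  by (simp add: times_sign_def one_sign_def)

text \<open>This trades the parity in \<open>balanced\<close> for a product in a commutative monoid,
  where signs can be regrouped and cancelled.\<close>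

lemma prod_sign_eq_1_iff:
  fixes f :: "'a \<Rightarrow> sign"
  assumes "finite A"
  shows "prod f A = 1 \<longleftrightarrow> even (card {x\<in>A. f x = Neg})"
  using assms
proof (induction A)
  case (insert a A)
  have "{x\<in>insert a A. f x = Neg} =
      (if f a = Neg then insert a {x\<in>A. f x = Neg} else {x\<in>A. f x = Neg})"
    by auto
  with insert show ?case
    by (cases "f a"; cases "prod f A") (simp_all add: times_sign_def one_sign_def)
qed simp

section \<open>Cycles as cyclic vertex lists\<close>

lemma cycle_edges_map: "cycle_edges (map f xs) = (`) f ` cycle_edges xs"
  unfolding cycle_edges_def image_image length_map
proof (rule image_cong)
  fix i assume "i \<in> {..<length xs}"
  moreover from this have "Suc i mod length xs < length xs"
    by (intro mod_less_divisor) auto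
  ultimately show "{map f xs ! i, map f xs ! (Suc i mod length xs)} =
      f ` {xs ! i, xs ! (Suc i mod length xs)}"
    by simp
qed simp

text \<open>With both indices reduced, the cycle can be traversed from any starting
  position.\<close>

lemma is_cycle_edge:
  assumes "is_cycle G xs"
  shows "{xs ! (i mod length xs), xs ! (Suc i mod length xs)} \<in> edges G"
proof -
  have "i mod length xs < length xs"
    using assms by (intro mod_less_divisor) (auto simp: is_cycle_def)
  then have "{xs ! (i mod length xs), xs ! (Suc (i mod length xs) mod length xs)} \<in> cycle_edges xs"
    unfolding cycle_edges_def by blast
  then show ?thesis
    using assms by (auto simp: is_cycle_def mod_Suc_eq)
qed

text \<open>This fails for length 2, where the two steps traverse the same edge.\<close>

lemma inj_on_cycle_edge:
  assumes "length xs \<ge> 3" and "distinct xs"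
  shows "inj_on (\<lambda>i. {xs ! i, xs ! (Suc i mod length xs)}) {..<length xs}"
proof (rule inj_onI)
  fix i j assume "i \<in> {..<length xs}" "j \<in> {..<length xs}"
    and "{xs ! i, xs ! (Suc i mod length xs)} = {xs ! j, xs ! (Suc j mod length xs)}"
  moreover have "Suc i mod length xs < length xs" "Suc j mod length xs < length xs"
    using assms(1) by (intro mod_less_divisor; linarith)+
  ultimately have "i = j \<or> (i = Suc j mod length xs \<and> Suc i mod length xs = j)"
    using assms(2) by (auto simp: doubleton_eq_iff nth_eq_iff_index_eq)
  \<comment> \<open>The crossed case would give \<open>i = i + 2\<close> modulo the length, which is
    at least 3.\<close>
  then show "i = j"
    using assms(1) \<open>i \<in> _\<close> \<open>j \<in> _\<close> by (auto simp: mod_Suc split: if_splits)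
qed

text \<open>Every vertex lies on exactly two edges of the cycle, so each \<open>t x\<close> enters
  the product of the signs twice and cancels. The factorisation is asked only on the vertices of the
  cycle because the edges of \<open>G1\<close> inside a corona need not satisfy it.\<close>

lemma even_negative_edges_if_potential:
  assumes cyc: "is_cycle G xs"
    and pot: "\<And>x y. x \<in> set xs \<Longrightarrow> y \<in> set xs \<Longrightarrow> {x, y} \<in> edges G \<Longrightarrow> esign G {x, y} = t x * t y"
  shows "even (card {e\<in>cycle_edges xs. esign G e = Neg})"
proof -
  define n where "n = length xs"
  have n: "n \<ge> 3" and "distinct xs"
    using cyc by (auto simp: is_cycle_def n_def)
  have succ_lt: "Suc i mod n < n" for i
    using n by (intro mod_less_divisor) linarith
  \<comment> \<open>Rotation permutes the indices, so the product over second endpoints equals the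
    product over first endpoints.\<close>
  have "inj_on (\<lambda>i. Suc i mod n) {..<n}"
    by (rule inj_onI) (auto simp: mod_Suc split: if_splits)
  moreover from this have "(\<lambda>i. Suc i mod n) ` {..<n} = {..<n}"
    using succ_lt by (intro endo_inj_surj) auto
  ultimately have shift: "(\<Prod>i<n. t (xs ! (Suc i mod n))) = (\<Prod>i<n. t (xs ! i))"
    using prod.reindex[of "\<lambda>i. Suc i mod n" "{..<n}" "\<lambda>i. t (xs ! i)"] by simp
  have "prod (esign G) (cycle_edges xs) = (\<Prod>i<n. esign G {xs ! i, xs ! (Suc i mod n)})"
    using prod.reindex[OF inj_on_cycle_edge[OF _ \<open>distinct xs\<close>], of "esign G"] n
    by (simp add: cycle_edges_def n_def)
  also have "\<dots> = (\<Prod>i<n. t (xs ! i) * t (xs ! (Suc i mod n)))"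
  proof (rule prod.cong)
    fix i assume "i \<in> {..<n}"
    then have "{xs ! i, xs ! (Suc i mod n)} \<in> edges G"
      using is_cycle_edge[OF cyc, of i] by (simp add: n_def)
    with \<open>i \<in> {..<n}\<close> succ_lt
    show "esign G {xs ! i, xs ! (Suc i mod n)} = t (xs ! i) * t (xs ! (Suc i mod n))"
      by (intro pot) (auto simp: n_def)
  qed simp
  also have "\<dots> = 1"
    by (simp add: prod.distrib shift)
  finally show ?thesis
    by (subst (asm) prod_sign_eq_1_iff) (auto simp: cycle_edges_def)
qed

text \<open>A cycle passes through \<open>a\<close> at most once. Without \<open>a\<close> it is
  still connected, and no edge between its remaining vertices leaves or enters
  \<open>S\<close>.\<close>

lemma cycle_confined_by_cut_vertex:
  assumes cyc: "is_cycle G xs" and meets: "set xs \<inter> S \<noteq> {}"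
    and cut: "\<And>x y. {x, y} \<in> edges G \<Longrightarrow> x \<in> S \<Longrightarrow> y \<in> insert a S"
  shows "set xs \<subseteq> insert a S"
proof -
  define n where "n = length xs"
  have n: "n \<ge> 3" and dist: "distinct xs"
    using cyc by (auto simp: is_cycle_def n_def)
  \<comment> \<open>\<open>k\<close> is the position of \<open>a\<close>; if \<open>a\<close> is not
    on the cycle, the condition is vacuous and 0 serves.\<close>
  obtain k where k: "k < n" "\<And>i. i < n \<Longrightarrow> xs ! i = a \<Longrightarrow> i = k"
  proof (cases "a \<in> set xs")
    case True
    then show ?thesis
      using that dist by (metis in_set_conv_nth n_def nth_eq_iff_index_eq)
  next
    case False
    then show ?thesis
      using that[of 0] n by (metis n_def neq0_conv not_numeral_le_zero nth_mem)
  qed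
  \<comment> \<open>The cycle is rotated to start at position \<open>k\<close>, so that only
    \<open>c 0\<close> can be \<open>a\<close>.\<close>
  define c where "c i = xs ! ((i + k) mod n)" for i
  have edge: "{c i, c (Suc i)} \<in> edges G" for i
    using is_cycle_edge[OF cyc, of "i + k"] by (simp add: c_def n_def)
  have not_a: "c i \<noteq> a" if "0 < i" "i < n" for i
  proof
    assume "c i = a"
    moreover have "(i + k) mod n < n"
      using n by (intro mod_less_divisor) linarith
    ultimately have "(i + k) mod n = k"
      using k(2)[of "(i + k) mod n"] by (simp add: c_def)
    with that k(1) show False
      by (cases "i + k < n") (simp_all add: le_mod_geq)
  qed
  have step: "c i \<in> S \<longleftrightarrow> c (Suc i) \<in> S" if "0 < i" "Suc i < n" for i
    using that edge[of i] cut[of "c i" "c (Suc i)"] cut[of "c (Suc i)" "c i"]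
      not_a[of i] not_a[of "Suc i"] by (auto simp: insert_commute)
  have const: "c (Suc i) \<in> S \<longleftrightarrow> c 1 \<in> S" if "Suc i < n" for i
    using that by (induction i) (use step in auto)
  have range: "set xs = c ` {..<n}"
  proof (intro equalityI subsetI)
    fix x assume "x \<in> set xs"
    then obtain j where j: "j < n" "x = xs ! j"
      by (auto simp: in_set_conv_nth n_def)
    \<comment> \<open>This is \<open>j - k\<close> modulo \<open>n\<close>, arranged so that the
      subtraction is not truncated.\<close>
    define i where "i = (if k \<le> j then j - k else j + n - k)"
    have "i < n" "(i + k) mod n = j"
      using j k(1) by (auto simp: i_def)
    then show "x \<in> c ` {..<n}"
      using j by (auto simp: c_def)
  qed (use n in \<open>auto simp: c_def n_def intro!: nth_mem mod_less_divisor\<close>)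
  obtain j where j: "j < n" "c j \<in> S"
    using meets range by auto
  \<comment> \<open>\<open>const\<close> covers only the positions from 1 on; position 0 is linked
    to them by the first edge.\<close>
  have c1: "c 1 \<in> S"
  proof (cases j)
    case 0
    then show ?thesis
      using j edge[of 0] cut[of "c 0" "c 1"] not_a[of 1] n by auto
  next
    case (Suc i)
    then show ?thesis
      using j const[of i] by simp
  qed
  have "c i \<in> insert a S" if "i < n" for i
  proof (cases i)
    case 0
    then show ?thesis
      using edge[of 0] cut[of "c 1" "c 0"] c1 by (simp add: insert_commute)
  next
    case (Suc j)
    then show ?thesis
      using that const[of j] c1 by simp
  qed
  then show ?thesis
    using range by auto
qed

section \<open>Cycles of the corona product\<close>

lemma even_negative_edges_base_cycle:
  assumes "balanced G1" and cyc: "is_cycle (corona G1 G2) xs" and "set xs \<subseteq> range Inl"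
  shows "even (card {e\<in>cycle_edges xs. esign (corona G1 G2) e = Neg})"
proof -
  obtain ys where xs: "xs = map Inl ys"
    using assms(3) by (metis ex_map_conv subset_iff imageE)
  have inj: "inj ((`) (Inl :: 'a \<Rightarrow> 'a + 'a \<times> 'b))"
    by (simp add: inj_image_eq_iff inj_def)
  have sub: "e \<in> edges G1" if e: "e \<in> cycle_edges ys" for e
  proof -
    obtain x y where xy: "e = {x, y}"
      using e unfolding cycle_edges_def by blast
    have "Inl ` e \<in> edges (corona G1 G2)"
      using cyc e by (auto simp: is_cycle_def xs cycle_edges_map)
    then show ?thesis
      by (auto simp: xy corona_def doubleton_eq_iff insert_commute)
  qed
  have "is_cycle G1 ys"
    using cyc sub by (auto simp: is_cycle_def xs distinct_map corona_def)
  then have "even (card {e\<in>cycle_edges ys. esign G1 e = Neg})"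
    using \<open>balanced G1\<close> by (simp add: balanced_def)
  moreover have "esign (corona G1 G2) (Inl ` e) = esign G1 e" for e
    by (auto simp: corona_def corona_sign_def image_iff)
  then have "{e\<in>cycle_edges xs. esign (corona G1 G2) e = Neg} =
      (`) Inl ` {e\<in>cycle_edges ys. esign G1 e = Neg}"
    by (auto simp: xs cycle_edges_map)
  ultimately show ?thesis
    by (simp add: card_image inj_on_subset[OF inj])
qed

lemma balanced_corona:
  assumes "simple_graph G1" and "balanced G1"
    and good: "\<And>v w. {v, w} \<in> edges G2 \<Longrightarrow> esign G2 {v, w} = mark G2 v * mark G2 w"
  shows "balanced (corona G1 G2)"
  unfolding balanced_def
proof (intro allI impI)
  fix xs assume cyc: "is_cycle (corona G1 G2) xs"
  show "even (card {e\<in>cycle_edges xs. esign (corona G1 G2) e = Neg})"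
  proof (cases "set xs \<subseteq> range Inl")
    case True
    with \<open>balanced G1\<close> cyc show ?thesis
      by (rule even_negative_edges_base_cycle)
  next
    case False
    then obtain z where "z \<in> set xs" "z \<notin> range Inl"
      by auto
    then obtain u v where uv: "Inr (u, v) \<in> set xs"
      by (metis obj_sumE rangeI surj_pair)
    \<comment> \<open>Edges from this fibre over \<open>u\<close> lead only back into it or to
      \<open>Inl u\<close>, which makes \<open>Inl u\<close> the cut vertex.\<close>
    let ?S = "range (\<lambda>w. Inr (u, w))"
    have confined: "set xs \<subseteq> insert (Inl u) ?S"
      using cyc
    proof (rule cycle_confined_by_cut_vertex)
      show "set xs \<inter> ?S \<noteq> {}"
        using uv by auto
    qed (auto simp: corona_def doubleton_eq_iff)
    \<comment> \<open>This excludes the case \<open>x = y = Inl u\<close> below, where the sign of a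
      loop would be asked for.\<close>
    have no_loop: "{Inl u, Inl u} \<notin> edges (corona G1 G2)"
      using \<open>simple_graph G1\<close> by (force simp: simple_graph_def corona_def doubleton_eq_iff)
    have copy: "{v, w} \<in> edges G2" if "{Inr (u, v), Inr (u, w)} \<in> edges (corona G1 G2)" for v w
      using that by (auto simp: corona_def doubleton_eq_iff insert_commute)
    have join': "esign (corona G1 G2) {Inr (u, v), Inl u} = mark G2 v * mark G1 u" for v
      using corona_sign_join[of G1 G2 u v] by (simp add: insert_commute mult.commute)
    show ?thesis
      using cyc
    proof (rule even_negative_edges_if_potential)
      fix x y assume "x \<in> set xs" "y \<in> set xs" and "{x, y} \<in> edges (corona G1 G2)"
      moreover from this have "x \<in> insert (Inl u) ?S" "y \<in> insert (Inl u) ?S"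
        using confined by auto
      \<comment> \<open>The potential is the marking itself: that of \<open>G1\<close> at
        \<open>Inl u\<close> and that of \<open>G2\<close> on the copy.\<close>
      ultimately show "esign (corona G1 G2) {x, y} =
          case_sum (mark G1) (mark G2 \<circ> snd) x * case_sum (mark G1) (mark G2 \<circ> snd) y"
        using no_loop
        by (auto simp: corona_sign_join join' corona_sign_copy good dest!: copy simp del: insert_absorb2)
    qed
  qed
qed

lemma unbalanced_corona:
  assumes "simple_graph G1" and "simple_graph G2"
    and edge: "{v, w} \<in> edges G2" and bad: "esign G2 {v, w} \<noteq> mark G2 v * mark G2 w"
  shows "\<not> balanced (corona G1 G2)"
proof
  assume bal: "balanced (corona G1 G2)"
  obtain u where u: "u \<in> verts G1"
    using assms(1) by (auto simp: simple_graph_def)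
  have vw: "v \<in> verts G2" "w \<in> verts G2" "v \<noteq> w"
    using assms(2) edge by (force simp: simple_graph_def doubleton_eq_iff)+
  let ?a = "Inl u :: 'a + 'a \<times> 'b" and ?b = "Inr (u, v)" and ?c = "Inr (u, w)"
  have C: "cycle_edges [?a, ?b, ?c] = {{?a, ?b}, {?b, ?c}, {?a, ?c}}"
    by (auto simp: cycle_edges_def lessThan_Suc insert_commute)
  have "{?a, ?b} \<in> edges (corona G1 G2)" "{?b, ?c} \<in> edges (corona G1 G2)"
    "{?a, ?c} \<in> edges (corona G1 G2)"
    using u vw edge by (auto simp: corona_def)
  then have "is_cycle (corona G1 G2) [?a, ?b, ?c]"
    unfolding is_cycle_def C using u vw by (auto simp: corona_def)
  with bal have "even (card {e\<in>cycle_edges [?a, ?b, ?c]. esign (corona G1 G2) e = Neg})"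
    by (simp add: balanced_def)
  then have "prod (esign (corona G1 G2)) {{?a, ?b}, {?b, ?c}, {?a, ?c}} = 1"
    unfolding C by (subst prod_sign_eq_1_iff) simp_all
  \<comment> \<open>The mark of \<open>u\<close> occurs in both joining edges and cancels, so any
    vertex of \<open>G1\<close> serves as apex of the triangle.\<close>
  then have "mark G1 u * mark G2 v * (esign G2 {v, w} * (mark G1 u * mark G2 w)) = 1"
    using vw by (simp add: doubleton_eq_iff corona_sign_join corona_sign_copy)
  with bad show False
    by (cases "mark G1 u"; cases "mark G2 v"; cases "mark G2 w"; cases "esign G2 {v, w}")
      (simp_all add: times_sign_def one_sign_def)
qed

theorem theorem1:
  fixes G1 :: "'a marked_sgraph" and G2 :: "'b marked_sgraph"
  assumes "signed_graph G1" and "signed_graph G2"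
    and "balanced G1" and "balanced G2"
  shows "\<not> balanced (corona G1 G2) \<longleftrightarrow>
    (\<exists>u v. {u, v} \<in> edges G2 \<and>
      (esign G2 {u, v} = Pos \<and> mark G2 u \<noteq> mark G2 v \<or>
       esign G2 {u, v} = Neg \<and> mark G2 u = Pos \<and> mark G2 v = Pos \<or>
       esign G2 {u, v} = Neg \<and> mark G2 u = Neg \<and> mark G2 v = Neg))"
proof -
  have simple: "simple_graph G1" "simple_graph G2"
    using assms by (auto simp: signed_graph_def)
  have bad_iff: "(s = Pos \<and> a \<noteq> b \<or> s = Neg \<and> a = Pos \<and> b = Pos \<or> s = Neg \<and> a = Neg \<and> b = Neg)
      \<longleftrightarrow> s \<noteq> a * b" for s a b :: sign
    by (cases s; cases a; cases b) (simp_all add: times_sign_def one_sign_def)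
  show ?thesis
    unfolding bad_iff
  proof
    assume "\<not> balanced (corona G1 G2)"
    with balanced_corona[OF simple(1) assms(3)]
    show "\<exists>u v. {u, v} \<in> edges G2 \<and> esign G2 {u, v} \<noteq> mark G2 u * mark G2 v"
      by metis
  next
    assume "\<exists>u v. {u, v} \<in> edges G2 \<and> esign G2 {u, v} \<noteq> mark G2 u * mark G2 v"
    then show "\<not> balanced (corona G1 G2)"
      by (elim exE conjE) (rule unbalanced_corona[OF simple])
  qed
qed

end
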